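(* Let $X$ be an ordered set such that the duplication of $X$ is representable. Then $X^\omega$ endowed with the lexicographical ordering is also representable.
   Context: "Ordered set" means linearly ordered set. Two ordered sets are similar if there is an order preserving bijection between them. Real valued functions are partially ordered pointwise: $f\le g$ iff $f(x)\le g(x)$ for all $x$. An ordered set is representable if it is similar to a set of Baire 1 functions $\mathbb{R}\to\mathbb{R}$ that is linearly ordered by the pointwise ordering. The duplication of an ordered set $X$ is $X\times\{0,1\}$ with the lexicographical ordering. $X^\omega$ is the set of sequences of length $\omega$ in $X$. *)

theory Defs
  imports "HOL-Analysis.Analysis"
begin

text \<open>
  An ordered set is a carrier \<open>X\<close> with a reflexive relation \<open>r\<close> such that
  \<open>linear_order_on X r\<close>; this includes the requirement \<open>r \<subseteq> X \<times> X\<close>.  The empty order is allowed.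
\<close>

definition similar :: "'a set \<Rightarrow> 'a rel \<Rightarrow> 'b set \<Rightarrow> 'b rel \<Rightarrow> bool" where
  "similar X r Y s \<longleftrightarrow>
     (\<exists>h. bij_betw h X Y \<and> (\<forall>x\<in>X. \<forall>y\<in>X. (x, y) \<in> r \<longleftrightarrow> (h x, h y) \<in> s))"

definition baire1 :: "(real \<Rightarrow> real) \<Rightarrow> bool" where
  "baire1 f \<longleftrightarrow>
     (\<exists>g :: nat \<Rightarrow> real \<Rightarrow> real. (\<forall>n. continuous_on UNIV (g n)) \<and> (\<forall>x. (\<lambda>n. g n x) \<longlonglongrightarrow> f x))"

text \<open>The library order \<open>\<le>\<close> on \<open>real \<Rightarrow> real\<close> is the pointwise one.\<close>

definition representable :: "'a set \<Rightarrow> 'a rel \<Rightarrow> bool" where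
  "representable X r \<longleftrightarrow>
     (\<exists>F :: (real \<Rightarrow> real) set.
        (\<forall>f\<in>F. baire1 f) \<and> linear_order_on F (relation_of (\<le>) F) \<and>
        similar X r F (relation_of (\<le>) F))"

definition duplication :: "'a set \<Rightarrow> ('a \<times> nat) set" where
  "duplication X = X \<times> {0, 1}"

definition duplication_order :: "'a set \<Rightarrow> 'a rel \<Rightarrow> ('a \<times> nat) rel" where
  "duplication_order X r =
     relation_of (\<lambda>(x, i) (y, j). (x, y) \<in> r - Id \<or> x = y \<and> i \<le> j) (duplication X)"

definition omega_power :: "'a set \<Rightarrow> (nat \<Rightarrow> 'a) set" where
  "omega_power X = UNIV \<rightarrow> X"

definition omega_power_order :: "'a set \<Rightarrow> 'a rel \<Rightarrow> (nat \<Rightarrow> 'a) rel" where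
  "omega_power_order X r =
     relation_of (\<lambda>s t. s = t \<or> (\<exists>n. (\<forall>i<n. s i = t i) \<and> (s n, t n) \<in> r - Id)) (omega_power X)"

lemma linear_order_on_duplication_order:
  assumes "linear_order_on X r"
  shows "linear_order_on (duplication X) (duplication_order X r)"
proof -
  from assms have tr: "trans r" and an: "antisym r" and to: "total_on X r"
    by (auto simp: order_on_defs)
  have "trans (duplication_order X r)"
  proof (rule transI)
    fix p q w :: "'a \<times> nat"
    assume "(p, q) \<in> duplication_order X r" "(q, w) \<in> duplication_order X r"
    then show "(p, w) \<in> duplication_order X r"
      using transD[OF tr, of "fst p" "fst q" "fst w"] antisymD[OF an, of "fst p" "fst q"]
      by (cases p; cases q; cases w) (auto simp: duplication_order_def relation_of_def)
  qed
  moreover have "antisym (duplication_order X r)"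
  proof (rule antisymI)
    fix p q :: "'a \<times> nat"
    assume "(p, q) \<in> duplication_order X r" "(q, p) \<in> duplication_order X r"
    then show "p = q"
      using antisymD[OF an, of "fst p" "fst q"]
      by (cases p; cases q) (auto simp: duplication_order_def relation_of_def)
  qed
  moreover have "total_on (duplication X) (duplication_order X r)"
    using to unfolding duplication_order_def relation_of_def duplication_def total_on_def
    by auto
  ultimately show ?thesis
    unfolding order_on_defs refl_on_def by (auto simp: duplication_order_def relation_of_def)
qed

lemma linear_order_on_omega_power_order:
  assumes "linear_order_on X r"
  shows "linear_order_on (omega_power X) (omega_power_order X r)"
proof -
  from assms have tr: "trans r" and an: "antisym r" and to: "total_on X r"
    by (auto simp: order_on_defs)
  define L where "L s t \<longleftrightarrow> (\<exists>n. (\<forall>i<n. s i = t i) \<and> (s n, t n) \<in> r - Id)" for s t :: "nat \<Rightarrow> 'a"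
  have L_trans: "L s u" if "L s t" "L t u" for s t u
  proof -
    from that obtain m n where m: "\<forall>i<m. s i = t i" "(s m, t m) \<in> r - Id"
      and n: "\<forall>i<n. t i = u i" "(t n, u n) \<in> r - Id" by (auto simp: L_def)
    have "(s (min m n), u (min m n)) \<in> r - Id"
    proof (cases m n rule: linorder_cases)
      case equal
      then show ?thesis
        using m n transD[OF tr, of "s n" "t n" "u n"] antisymD[OF an, of "s n" "t n"] by auto
    qed (use m n in \<open>auto simp: min_def\<close>)
    then show ?thesis unfolding L_def using m n by (intro exI[of _ "min m n"]) auto
  qed
  have L_irrefl: "\<not> L s s" for s by (auto simp: L_def)
  have L_total: "L s t \<or> L t s" if "s \<in> omega_power X" "t \<in> omega_power X" "s \<noteq> t" for s t
  proof -
    from \<open>s \<noteq> t\<close> have "\<exists>n. s n \<noteq> t n" by auto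
    then obtain n where n: "s n \<noteq> t n" and eq: "\<forall>i<n. s i = t i"
      using exists_least_iff[of "\<lambda>n. s n \<noteq> t n"] by auto
    have "s n \<in> X" "t n \<in> X"
      using that(1,2) unfolding omega_power_def by (auto simp: Pi_iff)
    then have "(s n, t n) \<in> r \<or> (t n, s n) \<in> r"
      using to n unfolding total_on_def by blast
    then have "(s n, t n) \<in> r - Id \<or> (t n, s n) \<in> r - Id"
      using n by auto
    then show ?thesis
    proof
      assume "(s n, t n) \<in> r - Id"
      then have "L s t" unfolding L_def using eq by (intro exI[of _ n] conjI)
      then show ?thesis ..
    next
      assume "(t n, s n) \<in> r - Id"
      then have "L t s" unfolding L_def using eq by (intro exI[of _ n] conjI) simp_all
      then show ?thesis ..
    qed
  qed
  have ord: "omega_power_order X r = relation_of (\<lambda>s t. s = t \<or> L s t) (omega_power X)"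
    by (simp add: omega_power_order_def L_def)
  have "trans (omega_power_order X r)"
    unfolding ord relation_of_def by (intro transI) (use L_trans in blast)
  moreover have "antisym (omega_power_order X r)"
    unfolding ord relation_of_def by (intro antisymI) (use L_trans L_irrefl in blast)
  moreover have "total_on (omega_power X) (omega_power_order X r)"
    unfolding ord relation_of_def total_on_def using L_total by blast
  ultimately show ?thesis
    unfolding order_on_defs refl_on_def by (auto simp: ord relation_of_def)
qed

end

theory Submission
  imports Defs
begin

text \<open>
  Squashing the values by \<open>arctan\<close>, the duplication of \<open>X\<close> is represented by Baire 1 functions
  \<open>f x 0 \<le> f x 1\<close> with values in \<open>[1/4, 3/4]\<close>.  At every point \<open>p\<close> the intervals
  \<open>[f x 0 p, f x 1 p]\<close>, \<open>x \<in> X\<close>, are arranged in the order of \<open>X\<close> with disjoint interiors, and for each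
  \<open>x\<close> there is a \<open>p\<close> at which the interval of \<open>x\<close> is nondegenerate.  Nesting these intervals, that
  is, placing the interval of \<open>s 1\<close> affinely inside that of \<open>s 0\<close>, that of \<open>s 2\<close> inside the result,
  and so on, where the \<open>k\<close>-th interval is taken at its own point \<open>p k\<close>, defines a function of
  \<open>(p 0, p 1, \<dots>)\<close> for each sequence \<open>s\<close>; it is weakly increasing in \<open>s\<close> lexicographically
  (lemma \<open>nested_mono\<close>).  If \<open>s\<close> and \<open>t\<close> first differ at \<open>n\<close> and the points \<open>p 0, \<dots>, p n\<close> are
  chosen such that the intervals of \<open>s 0, \<dots>, s n\<close> are nondegenerate, the values at \<open>s\<close> and \<open>t\<close> are
  different (lemma \<open>nested_strict_mono\<close>).  The gap of length \<open>1/4\<close> left at both ends of \<open>[0, 1]\<close>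
  keeps the nested value strictly below the right end point at every level, and it makes the lengths
  shrink geometrically, so that nested values of Baire 1 functions are Baire 1
  (lemma \<open>baire1_nested\<close>).

  To return to functions of one real variable, \<open>p k\<close> is replaced by \<open>curve k t\<close>, where the
  \<open>curve k\<close> are continuous functions of a real \<open>t\<close> that take any finitely many prescribed values
  \<open>p 0, \<dots>, p n\<close> simultaneously (lemma \<open>curve_surj\<close>).  They are obtained from Schoenberg's
  space-filling curve.
\<close>

section \<open>Nested intervals\<close>

text \<open>
  The number obtained by choosing \<open>a 0\<close> in \<open>[a 0, b 0]\<close>, then shifting it by the
  position of \<open>a 1\<close> in \<open>[0, 1]\<close> rescaled to the length \<open>b 0 - a 0\<close>, and so on: it is the
  common point of the nested intervals which arise from \<open>[0, 1]\<close> by composing the affine maps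
  that take \<open>[0, 1]\<close> to \<open>[a k, b k]\<close>.
\<close>
definition nested :: "(nat \<Rightarrow> real) \<Rightarrow> (nat \<Rightarrow> real) \<Rightarrow> real" where
  "nested a b = (\<Sum>k. (\<Prod>j<k. b j - a j) * a k)"

lemma nested_term_bound:
  fixes a b :: "nat \<Rightarrow> real"
  assumes "\<And>k. a k \<in> {1/4..3/4}" "\<And>k. b k \<in> {1/4..3/4}"
  shows "norm ((\<Prod>j<k. b j - a j) * a k) \<le> (1/2) ^ k"
proof -
  have "\<bar>\<Prod>j<k. b j - a j\<bar> \<le> (\<Prod>j<k. 1/2)"
    unfolding abs_prod
  proof (rule prod_mono)
    fix j
    have "1/4 \<le> a j" "a j \<le> 3/4" "1/4 \<le> b j" "b j \<le> 3/4"
      using assms(1)[of j] assms(2)[of j] by auto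
    then show "0 \<le> \<bar>b j - a j\<bar> \<and> \<bar>b j - a j\<bar> \<le> 1/2" by linarith
  qed
  moreover have "\<bar>a k\<bar> \<le> 1" using assms(1)[of k] by auto
  ultimately have "\<bar>\<Prod>j<k. b j - a j\<bar> * \<bar>a k\<bar> \<le> (1/2) ^ k * 1"
    by (intro mult_mono) auto
  then show ?thesis by (simp add: abs_mult)
qed

lemma summable_nested:
  fixes a b :: "nat \<Rightarrow> real"
  assumes "\<And>k. a k \<in> {1/4..3/4}" "\<And>k. b k \<in> {1/4..3/4}"
  shows "summable (\<lambda>k. (\<Prod>j<k. b j - a j) * a k)"
  by (rule summable_comparison_test'[OF summable_geometric[of "1/2::real"] nested_term_bound])
    (use assms in auto)

lemma nested_rec:
  fixes a b :: "nat \<Rightarrow> real"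
  assumes "\<And>k. a k \<in> {1/4..3/4}" "\<And>k. b k \<in> {1/4..3/4}"
  shows "nested a b = a 0 + (b 0 - a 0) * nested (\<lambda>k. a (Suc k)) (\<lambda>k. b (Suc k))"
proof -
  let ?f = "\<lambda>k. (\<Prod>j<k. b j - a j) * a k"
  let ?g = "\<lambda>k. (\<Prod>j<k. b (Suc j) - a (Suc j)) * a (Suc k)"
  have "nested a b = (\<Sum>k. ?f (Suc k)) + a 0"
    using suminf_split_head[OF summable_nested[of a b]] assms by (simp add: nested_def)
  also have "(\<Sum>k. ?f (Suc k)) = (\<Sum>k. (b 0 - a 0) * ?g k)"
    by (simp only: prod.lessThan_Suc_shift mult.assoc)
  also have "\<dots> = (b 0 - a 0) * (\<Sum>k. ?g k)"
    by (rule suminf_mult, rule summable_nested) (use assms in auto)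
  finally show ?thesis by (simp add: nested_def)
qed

lemma nested_unit:
  fixes a b :: "nat \<Rightarrow> real"
  assumes "\<And>k. a k \<in> {1/4..3/4}" "\<And>k. b k \<in> {1/4..3/4}" "\<And>k. a k \<le> b k"
  shows "nested a b \<in> {0..1}"
proof -
  let ?P = "\<lambda>k. \<Prod>j<k. b j - a j"
  have P: "0 \<le> ?P k" for k by (rule prod_nonneg) (use assms(3) in auto)
  have a: "0 \<le> a k" "b k - a k \<le> 1 - a k" for k
    using assms(1)[of k] assms(2)[of k] by auto
  have "0 \<le> nested a b"
    unfolding nested_def by (intro suminf_nonneg summable_nested assms mult_nonneg_nonneg P a)
  moreover have "(\<Sum>k<N. ?P k * a k) \<le> 1 - ?P N" for N
  proof (induction N)
    case (Suc N)
    have "?P N * (b N - a N) \<le> ?P N * (1 - a N)"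
      by (intro mult_left_mono P a)
    then show ?case using Suc by (simp add: algebra_simps)
  qed simp
  then have "(\<Sum>k<N. ?P k * a k) \<le> 1" for N
    using P[of N] by (meson diff_le_eq le_add_same_cancel1 order_trans)
  then have "nested a b \<le> 1"
    unfolding nested_def by (intro suminf_le_const summable_nested assms)
  ultimately show ?thesis by simp
qed

lemma nested_bounds:
  fixes a b :: "nat \<Rightarrow> real"
  assumes "\<And>k. a k \<in> {1/4..3/4}" "\<And>k. b k \<in> {1/4..3/4}" "\<And>k. a k \<le> b k"
  shows "nested a b \<in> {a 0..b 0}"
proof -
  let ?T = "nested (\<lambda>k. a (Suc k)) (\<lambda>k. b (Suc k))"
  have "?T \<in> {0..1}" by (rule nested_unit) (use assms in auto)
  then have "0 \<le> (b 0 - a 0) * ?T" "(b 0 - a 0) * ?T \<le> b 0 - a 0"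
    using assms(3)[of 0] by (auto intro: mult_left_le)
  then show ?thesis using nested_rec[of a b] assms by auto
qed

text \<open>
  The right end point is not attained, because the position inside \<open>[a 0, b 0]\<close> that the next
  intervals determine is at most \<open>3/4\<close> of its length.
\<close>

lemma nested_less:
  fixes a b :: "nat \<Rightarrow> real"
  assumes "\<And>k. a k \<in> {1/4..3/4}" "\<And>k. b k \<in> {1/4..3/4}" "\<And>k. a k \<le> b k" "a 0 < b 0"
  shows "nested a b < b 0"
proof -
  let ?T = "nested (\<lambda>k. a (Suc k)) (\<lambda>k. b (Suc k))"
  have "?T \<in> {a (Suc 0)..b (Suc 0)}" by (rule nested_bounds) (use assms in auto)
  then have "?T < 1" using assms(2)[of "Suc 0"] by auto
  then have "(b 0 - a 0) * ?T < (b 0 - a 0) * 1" using assms(4) by (intro mult_strict_left_mono) auto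
  then have "a 0 + (b 0 - a 0) * ?T < b 0" by simp
  then show ?thesis using nested_rec[of a b] assms by metis
qed

lemma nested_mono:
  fixes a b c d :: "nat \<Rightarrow> real"
  assumes "\<And>k. a k \<in> {1/4..3/4}" "\<And>k. b k \<in> {1/4..3/4}" "\<And>k. a k \<le> b k"
    and "\<And>k. c k \<in> {1/4..3/4}" "\<And>k. d k \<in> {1/4..3/4}" "\<And>k. c k \<le> d k"
    and "\<And>k. k < n \<Longrightarrow> a k = c k \<and> b k = d k" "b n \<le> c n"
  shows "nested a b \<le> nested c d"
  using assms
proof (induction n arbitrary: a b c d)
  case 0
  then show ?case using nested_bounds[of a b] nested_bounds[of c d] by auto
next
  case (Suc n)
  have "nested (\<lambda>k. a (Suc k)) (\<lambda>k. b (Suc k)) \<le> nested (\<lambda>k. c (Suc k)) (\<lambda>k. d (Suc k))"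
    by (rule Suc.IH) (use Suc.prems in auto)
  then show ?case
    using Suc.prems(3)[of 0] Suc.prems(7)[of 0] nested_rec[of a b] nested_rec[of c d] Suc.prems
    by (simp add: mult_left_mono)
qed

lemma nested_strict_mono:
  fixes a b c d :: "nat \<Rightarrow> real"
  assumes "\<And>k. a k \<in> {1/4..3/4}" "\<And>k. b k \<in> {1/4..3/4}" "\<And>k. a k \<le> b k"
    and "\<And>k. c k \<in> {1/4..3/4}" "\<And>k. d k \<in> {1/4..3/4}" "\<And>k. c k \<le> d k"
    and "\<And>k. k < n \<Longrightarrow> a k = c k \<and> b k = d k" "b n \<le> c n"
    and "\<And>k. k \<le> n \<Longrightarrow> a k < b k"
  shows "nested a b < nested c d"
  using assms
proof (induction n arbitrary: a b c d)
  case 0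
  then show ?case using nested_less[of a b] nested_bounds[of c d] by fastforce
next
  case (Suc n)
  have "nested (\<lambda>k. a (Suc k)) (\<lambda>k. b (Suc k)) < nested (\<lambda>k. c (Suc k)) (\<lambda>k. d (Suc k))"
    by (rule Suc.IH) (use Suc.prems in auto)
  then show ?case
    using Suc.prems(9)[of 0] Suc.prems(7)[of 0] nested_rec[of a b] nested_rec[of c d] Suc.prems
    by simp
qed

section \<open>Baire 1 functions\<close>

text \<open>An order embedding of the reals into \<open>(1/4, 3/4)\<close>.\<close>
definition squash :: "real \<Rightarrow> real" where
  "squash y = 1/2 + arctan y / (2 * pi)"

lemma squash_range: "squash y \<in> {1/4..3/4}"
proof -
  have "- (pi / 2) / (2 * pi) \<le> arctan y / (2 * pi)" "arctan y / (2 * pi) \<le> (pi / 2) / (2 * pi)"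
    using arctan_bounded[of y] by (intro divide_right_mono; simp)+
  then show ?thesis by (simp add: squash_def)
qed

lemma squash_less_iff: "squash x < squash y \<longleftrightarrow> x < y"
  by (simp add: squash_def divide_less_cancel arctan_less_iff)

lemma squash_le_iff: "squash x \<le> squash y \<longleftrightarrow> x \<le> y"
  by (simp add: linorder_not_less[symmetric] squash_less_iff)

lemma continuous_on_squash: "continuous_on UNIV squash"
  unfolding squash_def by (intro continuous_intros) auto

lemma baire1_nested:
  fixes p q :: "nat \<Rightarrow> real \<Rightarrow> real"
  assumes "\<And>k. baire1 (p k)" "\<And>k. baire1 (q k)"
    and c: "\<And>k. continuous_on UNIV (c k)"
  shows "baire1 (\<lambda>t. nested (\<lambda>k. squash (p k (c k t))) (\<lambda>k. squash (q k (c k t))))"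
proof -
  obtain P where P: "\<And>k n. continuous_on UNIV (P k n)" "\<And>k x. (\<lambda>n. P k n x) \<longlonglongrightarrow> p k x"
    using assms(1) unfolding baire1_def by metis
  obtain Q where Q: "\<And>k n. continuous_on UNIV (Q k n)" "\<And>k x. (\<lambda>n. Q k n x) \<longlonglongrightarrow> q k x"
    using assms(2) unfolding baire1_def by metis
  have cont: "continuous_on UNIV (\<lambda>t. squash (h (c k t)))" if "continuous_on UNIV h" for h k
    using continuous_on_compose2[OF continuous_on_squash continuous_on_compose2[OF that c]] by auto
  have lim: "(\<lambda>n. squash (h n)) \<longlonglongrightarrow> squash l" if "h \<longlonglongrightarrow> l" for h l
    using continuous_on_tendsto_compose[OF continuous_on_squash that] by auto
  \<comment> \<open>The approximants are cut off after \<open>n\<close> terms, so that they are finite sums.\<close>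
  define T where "T k n t = (\<Prod>j<k. squash (Q j n (c j t)) - squash (P j n (c j t)))
    * squash (P k n (c k t))" for k n t
  define G where "G n t = (\<Sum>k<n. T k n t)" for n t
  have "continuous_on UNIV (G n)" for n
    unfolding G_def T_def by (intro continuous_intros cont P Q)
  moreover have "(\<lambda>n. G n t) \<longlonglongrightarrow> nested (\<lambda>k. squash (p k (c k t))) (\<lambda>k. squash (q k (c k t)))" for t
  proof -
    define A where "A k n = (if k < n then T k n t else 0)" for k n
    let ?B = "\<lambda>k. (\<Prod>j<k. squash (q j (c j t)) - squash (p j (c j t))) * squash (p k (c k t))"
    have T: "(\<lambda>n. T k n t) \<longlonglongrightarrow> ?B k" for k
      unfolding T_def by (intro tendsto_intros lim P Q)
    have "A k \<longlonglongrightarrow> ?B k" for k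
      using T[of k]
      by (rule Lim_transform_eventually)
        (auto simp: A_def eventually_at_top_linorder intro: exI[of _ "Suc k"])
    moreover have "norm (A k n) \<le> (1/2) ^ k" for k n
      using nested_term_bound[of "\<lambda>k. squash (P k n (c k t))" "\<lambda>k. squash (Q k n (c k t))" k]
        squash_range by (auto simp: A_def T_def)
    then have "\<forall>\<^sub>F (k, n) in at_top \<times>\<^sub>F sequentially. norm (A k n) \<le> (1/2) ^ k"
      by (intro always_eventually) auto
    ultimately have "(\<lambda>n. \<Sum>k. A k n) \<longlonglongrightarrow> suminf ?B"
      using tannerys_theorem[of A ?B sequentially "\<lambda>k. (1/2) ^ k"] summable_geometric[of "1/2::real"]
      by simp
    moreover have "(\<Sum>k. A k n) = G n t" for n
      unfolding G_def by (subst suminf_finite[of "{..<n}"]) (auto simp: A_def)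
    ultimately show ?thesis by (simp add: nested_def)
  qed
  ultimately show ?thesis unfolding baire1_def by blast
qed

section \<open>A space-filling curve\<close>

text \<open>
  A function such as Schoenberg uses: it is continuous with period 2, equal to 0 on \<open>[0, 1/3]\<close> and
  to 1 on \<open>[2/3, 1]\<close>.  Truncating a cosine gives these properties without a case distinction.
\<close>
definition wave :: "real \<Rightarrow> real" where
  "wave t = max 0 (min 1 (1/2 - cos (pi * t)))"

lemma continuous_on_wave: "continuous_on UNIV (\<lambda>t. wave (m * t))"
  unfolding wave_def by (intro continuous_intros)

lemma wave_unit: "wave t \<in> {0..1}"
  by (auto simp: wave_def)

lemma cos_pi_even: "cos (pi * (2 * real m + t)) = cos (pi * t)"
proof -
  have "pi * (2 * real m + t) = pi * t + of_int (int m) * (2 * pi)" by (simp add: algebra_simps)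
  then show ?thesis using cos_add[of "pi * t" "of_int (int m) * (2 * pi)"]
    by (metis cos_int_2pin sin_int_2pin mult.commute mult_cancel_right2 mult_zero_right diff_zero)
qed

lemma wave_periodic: "wave (2 * real m + t) = wave t"
  by (simp add: wave_def cos_pi_even)

lemma wave_eq_0: "0 \<le> t \<Longrightarrow> t \<le> 1/3 \<Longrightarrow> wave t = 0"
proof -
  assume t: "0 \<le> t" "t \<le> 1/3"
  then have "cos (pi / 3) \<le> cos (pi * t)" by (intro cos_monotone_0_pi_le) auto
  then show ?thesis by (simp add: wave_def cos_60)
qed

lemma wave_eq_1: "2/3 \<le> t \<Longrightarrow> t \<le> 1 \<Longrightarrow> wave t = 1"
proof -
  assume t: "2/3 \<le> t" "t \<le> 1"
  then have "cos (pi * t) \<le> cos (pi * (2/3))" by (intro cos_monotone_0_pi_le) auto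
  also have "cos (pi * (2/3)) = - (1/2)" using cos_120 by (simp add: mult.commute)
  finally show ?thesis by (simp add: wave_def)
qed

text \<open>The point of the Cantor set with the ternary digits \<open>2 * a k\<close>, for \<open>a k \<in> {0, 1}\<close>.\<close>
definition cantor :: "(nat \<Rightarrow> nat) \<Rightarrow> real" where
  "cantor a = (\<Sum>k. 2 * real (a k) / 3 ^ Suc k)"

lemma cantor_bounds:
  assumes "\<And>k. a k \<le> 1"
  shows "summable (\<lambda>k. 2 * real (a k) / 3 ^ Suc k)" "cantor a \<in> {0..1}"
proof -
  have g: "(\<lambda>k. 2/3 * (1/3::real) ^ k) sums (2/3 * (1 / (1 - 1/3)))"
    by (intro sums_mult geometric_sums) auto
  have le: "2 * real (a k) / 3 ^ Suc k \<le> 2/3 * (1/3) ^ k" for k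
    using assms[of k] by (auto simp: field_simps power_divide)
  show s: "summable (\<lambda>k. 2 * real (a k) / 3 ^ Suc k)"
    by (rule summable_comparison_test'[OF sums_summable[OF g]]) (use le in auto)
  have "cantor a \<le> (\<Sum>k. 2/3 * (1/3::real) ^ k)"
    unfolding cantor_def by (intro suminf_le le s sums_summable[OF g])
  moreover have "0 \<le> cantor a" unfolding cantor_def by (intro suminf_nonneg s) auto
  ultimately show "cantor a \<in> {0..1}" using sums_unique[OF g] by simp
qed

lemma cantor_rec:
  assumes "\<And>k. a k \<le> 1"
  shows "3 * cantor a = 2 * real (a 0) + cantor (\<lambda>k. a (Suc k))"
proof -
  let ?g = "\<lambda>k. 2 * real (a (Suc k)) / 3 ^ Suc k"
  have "summable ?g" using cantor_bounds(1)[of "\<lambda>k. a (Suc k)"] assms by simp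
  then have "(\<Sum>k. ?g k / 3) = cantor (\<lambda>k. a (Suc k)) / 3"
    using suminf_divide[of ?g 3] by (simp add: cantor_def)
  moreover have "(\<Sum>k. ?g k / 3) = cantor a - 2 * real (a 0) / 3"
    using suminf_split_head[OF cantor_bounds(1), of a] assms by (simp add: cantor_def ac_simps)
  ultimately show ?thesis by simp
qed

text \<open>
  The wave reads off the digits: multiplication by \<open>3 ^ k\<close> moves the first \<open>k\<close> digits, all of them
  even, into an even integer, which the period of the wave removes.
\<close>

lemma wave_cantor:
  assumes "\<And>k. a k \<le> 1"
  shows "wave (3 ^ k * cantor a) = real (a k)"
  using assms
proof (induction k arbitrary: a)
  case 0
  have "cantor (\<lambda>k. a (Suc k)) \<in> {0..1}" by (rule cantor_bounds) (use 0 in auto)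
  moreover have "a 0 = 0 \<or> a 0 = 1" using 0[of 0] by auto
  ultimately show ?case
    using cantor_rec[of a] 0 wave_eq_0[of "cantor a"] wave_eq_1[of "cantor a"] by auto
next
  case (Suc k)
  have "3 ^ Suc k * cantor a = 3 ^ k * (3 * cantor a)" by simp
  also have "\<dots> = 2 * real (3 ^ k * a 0) + 3 ^ k * cantor (\<lambda>k. a (Suc k))"
    using cantor_rec[of a] Suc.prems by (simp add: algebra_simps)
  finally show ?case using Suc by (simp add: wave_periodic del: of_nat_mult)
qed

lemma binary_expansion:
  fixes u :: real
  assumes "0 \<le> u" "u < 1"
  obtains a :: "nat \<Rightarrow> nat" where "\<And>k. a k \<le> 1" "(\<lambda>k. real (a k) / 2 ^ Suc k) sums u"
proof
  define a where "a k = nat (\<lfloor>2 ^ Suc k * u\<rfloor> mod 2)" for k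
  show "a k \<le> 1" for k by (simp add: a_def)
  have double: "\<lfloor>2 * y\<rfloor> = 2 * \<lfloor>y\<rfloor> + \<lfloor>2 * y\<rfloor> mod 2" for y :: real
  proof -
    have "\<lfloor>2 * y\<rfloor> = 2 * \<lfloor>y\<rfloor> \<or> \<lfloor>2 * y\<rfloor> = 2 * \<lfloor>y\<rfloor> + 1" by linarith
    then show ?thesis by auto
  qed
  have part: "(\<Sum>k<N. real (a k) / 2 ^ Suc k) = of_int \<lfloor>2 ^ N * u\<rfloor> / 2 ^ N" for N
  proof (induction N)
    case 0
    then show ?case using assms by (simp add: floor_eq_iff)
  next
    case (Suc N)
    have "real_of_int \<lfloor>2 ^ Suc N * u\<rfloor> = 2 * of_int \<lfloor>2 ^ N * u\<rfloor> + real (a N)"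
      using arg_cong[OF double[of "2 ^ N * u"], of real_of_int] by (simp add: a_def mult.assoc)
    then show ?case using Suc by (simp add: field_simps)
  qed
  have "(\<lambda>N. of_int \<lfloor>2 ^ N * u\<rfloor> / 2 ^ N) \<longlonglongrightarrow> u"
  proof (rule tendsto_sandwich[where f = "\<lambda>N. u - (1/2) ^ N" and h = "\<lambda>N. u"])
    have "u - (1/2) ^ N \<le> of_int \<lfloor>2 ^ N * u\<rfloor> / 2 ^ N" for N
    proof -
      have "2 ^ N * u - 1 \<le> of_int \<lfloor>2 ^ N * u\<rfloor>" by linarith
      then have "(2 ^ N * u - 1) / 2 ^ N \<le> of_int \<lfloor>2 ^ N * u\<rfloor> / 2 ^ N"
        by (intro divide_right_mono) auto
      then show ?thesis by (simp add: diff_divide_distrib power_divide)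
    qed
    then show "\<forall>\<^sub>F N in sequentially. u - (1/2) ^ N \<le> of_int \<lfloor>2 ^ N * u\<rfloor> / 2 ^ N"
      by simp
    have "of_int \<lfloor>2 ^ N * u\<rfloor> / 2 ^ N \<le> u" for N
      by (simp add: field_simps)
    then show "\<forall>\<^sub>F N in sequentially. of_int \<lfloor>2 ^ N * u\<rfloor> / 2 ^ N \<le> u" by simp
    have "(\<lambda>N. u - (1/2) ^ N) \<longlonglongrightarrow> u - 0" by (intro tendsto_intros LIMSEQ_power_zero) auto
    then show "(\<lambda>N. u - (1/2) ^ N) \<longlonglongrightarrow> u" by simp
  qed auto
  then show "(\<lambda>k. real (a k) / 2 ^ Suc k) sums u" unfolding sums_def part .
qed

text \<open>
  The coordinates of Schoenberg's curve in the Hilbert cube: \<open>t\<close> encodes binary digits in base 3, and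
  those at the places \<open>prod_encode (j, n)\<close> form the \<open>j\<close>-th coordinate.
\<close>
definition coord :: "nat \<Rightarrow> real \<Rightarrow> real" where
  "coord j t = (\<Sum>n. wave (3 ^ prod_encode (j, n) * t) / 2 ^ Suc n)"

lemma continuous_on_coord: "continuous_on UNIV (coord j)"
proof -
  have "uniform_limit UNIV (\<lambda>N t. \<Sum>n<N. wave (3 ^ prod_encode (j, n) * t) / 2 ^ Suc n)
     (coord j) sequentially"
    unfolding coord_def
  proof (rule Weierstrass_m_test)
    show "norm (wave (3 ^ prod_encode (j, n) * t) / 2 ^ Suc n) \<le> (1/2) ^ n" for n t
      using wave_unit[of "3 ^ prod_encode (j, n) * t"] by (simp add: field_simps power_divide)
  qed (auto intro: summable_geometric)
  then show ?thesis
  proof (rule uniform_limit_theorem[rotated])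
    show "\<forall>\<^sub>F N in sequentially. continuous_on UNIV
        (\<lambda>t. \<Sum>n<N. wave (3 ^ prod_encode (j, n) * t) / 2 ^ Suc n)"
      by (intro always_eventually allI continuous_intros continuous_on_wave) auto
  qed auto
qed

lemma coord_periodic: "coord j (2 * real m + t) = coord j t"
proof -
  have "wave (3 ^ k * (2 * real m + t)) = wave (3 ^ k * t)" for k
    using wave_periodic[of "3 ^ k * m" "3 ^ k * t"] by (simp add: algebra_simps)
  then show ?thesis by (simp add: coord_def)
qed

lemma coord_surj:
  fixes u :: "nat \<Rightarrow> real"
  assumes "\<And>j. 0 \<le> u j" "\<And>j. u j < 1"
  obtains t where "t \<in> {0..1}" "\<And>j. coord j t = u j"
proof -
  have "\<forall>j. \<exists>a :: nat \<Rightarrow> nat. (\<forall>k. a k \<le> 1) \<and> (\<lambda>k. real (a k) / 2 ^ Suc k) sums u j"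
    using binary_expansion assms by metis
  then obtain a :: "nat \<Rightarrow> nat \<Rightarrow> nat"
    where a: "\<And>j k. a j k \<le> 1" "\<And>j. (\<lambda>k. real (a j k) / 2 ^ Suc k) sums u j" by metis
  define b where "b k = case_prod a (prod_decode k)" for k
  have b: "b k \<le> 1" for k using a(1) by (simp add: b_def split: prod.split)
  have "coord j (cantor b) = u j" for j
    unfolding coord_def wave_cantor[OF b] using sums_unique[OF a(2)[of j]] by (simp add: b_def)
  with cantor_bounds(2)[of b] b show thesis by (intro that) auto
qed

text \<open>
  The coordinates rescaled from \<open>[0, 1]\<close> to ever larger intervals.  The first factor is continuous
  and equals the constant \<open>2 m\<close> on \<open>[2 m, 2 m + 1]\<close>, since \<open>arccos (cos (pi * t)) / pi\<close> is the
  triangular wave of period 2 that is \<open>t\<close> on \<open>[0, 1]\<close>; there the curves take all sequences of values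
  in \<open>(-2 m, 2 m)\<close>.
\<close>
definition curve :: "nat \<Rightarrow> real \<Rightarrow> real" where
  "curve j t = (t - arccos (cos (pi * t)) / pi) * (2 * coord j t - 1)"

lemma continuous_on_curve: "continuous_on UNIV (curve j)"
  unfolding curve_def by (intro continuous_intros continuous_on_coord) auto

lemma curve_surj:
  fixes p :: "nat \<Rightarrow> real"
  obtains t where "\<And>k. k \<le> n \<Longrightarrow> curve k t = p k"
proof -
  obtain m :: nat where m: "Max ((\<lambda>k. \<bar>p k\<bar>) ` {..n}) < real m"
    using reals_Archimedean2 by blast
  have p: "\<bar>p k\<bar> < real m" if "k \<le> n" for k
    using m that by (subst (asm) Max_less_iff) auto
  have m0: "0 < real m" using p[of 0] by linarith
  \<comment> \<open>Chosen such that \<open>2 * m * (2 * u k - 1) = p k\<close>; the values beyond \<open>n\<close> are irrelevant.\<close>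
  define u where "u k = (if k \<le> n then (p k / (2 * real m) + 1) / 2 else 0)" for k
  have "0 \<le> u k" "u k < 1" for k
    using p[of k] m0 by (auto simp: u_def field_simps)
  then obtain t where t: "t \<in> {0..1}" "\<And>j. coord j t = u j" using coord_surj[of u] by metis
  have "arccos (cos (pi * t)) = pi * t" using t(1) by (intro arccos_cos) auto
  then have curve: "curve k (2 * real m + t) = 2 * real m * (2 * u k - 1)" for k
    by (simp add: curve_def cos_pi_even coord_periodic t(2))
  have "curve k (2 * real m + t) = p k" if "k \<le> n" for k
  proof -
    have "2 * u k - 1 = p k / (2 * real m)"
      using that by (simp add: u_def diff_divide_distrib add_divide_distrib)
    then show ?thesis using curve[of k] m0 by simp
  qed
  then show thesis by (rule that)
qed

section \<open>Representing the lexicographic power\<close>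

lemma representableI:
  assumes "linear_order_on X r"
    and "\<And>x. x \<in> X \<Longrightarrow> baire1 (\<Phi> x)"
    and less: "\<And>x y. (x, y) \<in> r \<Longrightarrow> x \<noteq> y \<Longrightarrow> \<Phi> x < \<Phi> y"
  shows "representable X r"
proof -
  have refl: "(x, x) \<in> r" if "x \<in> X" for x
    using assms(1) that by (auto simp: order_on_defs refl_on_def)
  have tot: "(x, y) \<in> r \<or> (y, x) \<in> r" if "x \<in> X" "y \<in> X" for x y
    using assms(1) that refl unfolding order_on_defs total_on_def by metis
  have iff: "(x, y) \<in> r \<longleftrightarrow> \<Phi> x \<le> \<Phi> y" if "x \<in> X" "y \<in> X" for x y
    using tot[OF that] refl less[of x y] less[of y x] that by (metis less_le_not_le order_refl)
  have inj: "inj_on \<Phi> X"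
    by (rule inj_onI) (metis less tot less_irrefl)
  have "linear_order_on (\<Phi> ` X) (relation_of (\<le>) (\<Phi> ` X))"
    unfolding order_on_defs refl_on_def
    by (auto simp: relation_of_def total_on_def intro!: transI antisymI)
      (metis iff tot)+
  moreover have "similar X r (\<Phi> ` X) (relation_of (\<le>) (\<Phi> ` X))"
    unfolding similar_def
    by (rule exI[of _ \<Phi>]) (use inj iff in \<open>auto simp: bij_betw_def relation_of_def\<close>)
  ultimately show ?thesis
    unfolding representable_def using assms(2) by (intro exI[of _ "\<Phi> ` X"]) auto
qed

lemma representable_duplicationE:
  assumes "representable (duplication X) (duplication_order X r)" "linear_order_on X r"
  obtains f :: "'a \<Rightarrow> nat \<Rightarrow> real \<Rightarrow> real"
  where "\<And>x i. x \<in> X \<Longrightarrow> i \<in> {0, 1} \<Longrightarrow> baire1 (f x i)"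
    and "\<And>x. x \<in> X \<Longrightarrow> f x 0 < f x 1"
    and "\<And>x y. (x, y) \<in> r \<Longrightarrow> x \<noteq> y \<Longrightarrow> f x 1 \<le> f y 0"
proof -
  obtain F :: "(real \<Rightarrow> real) set" and h where F: "\<And>g. g \<in> F \<Longrightarrow> baire1 g"
    and h: "bij_betw h (duplication X) F"
    and ord: "\<And>v w. v \<in> duplication X \<Longrightarrow> w \<in> duplication X \<Longrightarrow>
      (v, w) \<in> duplication_order X r \<longleftrightarrow> (h v, h w) \<in> relation_of (\<le>) F"
    using assms(1) unfolding representable_def similar_def by blast
  have r: "x \<in> X" "y \<in> X" if "(x, y) \<in> r" for x y
    using assms(2) that by (auto simp: order_on_defs refl_on_def)
  have dup: "(x, i) \<in> duplication X" if "x \<in> X" "i \<in> {0, 1}" for x i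
    using that by (auto simp: duplication_def)
  show thesis
  proof
    show "baire1 (curry h x i)" if "x \<in> X" "i \<in> {0, 1}" for x i
      using bij_betwE[OF h] dup[OF that] F by auto
    show "curry h x 0 < curry h x 1" if "x \<in> X" for x
    proof -
      have "((x, 0), (x, 1)) \<in> duplication_order X r"
        using that by (auto simp: duplication_order_def relation_of_def duplication_def)
      then have "h (x, 0) \<le> h (x, 1)"
        using ord[OF dup dup, of x 0 x 1] that by (simp add: relation_of_def)
      moreover have "h (x, 0) \<noteq> h (x, 1)"
        using inj_onD[OF bij_betw_imp_inj_on[OF h], of "(x, 0)" "(x, 1)"] dup that by auto
      ultimately show ?thesis by simp
    qed
    show "curry h x 1 \<le> curry h y 0" if "(x, y) \<in> r" "x \<noteq> y" for x y
    proof -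
      have "((x, 1), (y, 0)) \<in> duplication_order X r"
        using that r by (auto simp: duplication_order_def relation_of_def duplication_def)
      then show ?thesis
        using ord[OF dup dup, of x 1 y 0] that r by (simp add: relation_of_def)
    qed
  qed
qed

theorem mainTheorem5:
  fixes X :: "'a set" and r :: "'a rel"
  assumes "linear_order_on X r"
    and "representable (duplication X) (duplication_order X r)"
  shows "representable (omega_power X) (omega_power_order X r)"
proof -
  obtain f :: "'a \<Rightarrow> nat \<Rightarrow> real \<Rightarrow> real"
    where baire: "\<And>x i. x \<in> X \<Longrightarrow> i \<in> {0, 1} \<Longrightarrow> baire1 (f x i)"
      and less: "\<And>x. x \<in> X \<Longrightarrow> f x 0 < f x 1"
      and le: "\<And>x y. (x, y) \<in> r \<Longrightarrow> x \<noteq> y \<Longrightarrow> f x 1 \<le> f y 0"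
    using representable_duplicationE[OF assms(2,1)] by blast
  define lo where "lo s t k = squash (f (s k) 0 (curve k t))" for s :: "nat \<Rightarrow> 'a" and t k
  define hi where "hi s t k = squash (f (s k) 1 (curve k t))" for s :: "nat \<Rightarrow> 'a" and t k
  have in_X: "s k \<in> X" if "s \<in> omega_power X" for s k
    using that by (auto simp: omega_power_def Pi_iff)
  have lo_hi: "lo s t k \<le> hi s t k" if "s \<in> omega_power X" for s t k
    using less[OF in_X[OF that]] by (auto simp: lo_def hi_def squash_le_iff less_fun_def le_fun_def)
  have range: "lo s t k \<in> {1/4..3/4}" "hi s t k \<in> {1/4..3/4}" for s t k
    unfolding lo_def hi_def by (rule squash_range)+
  \<comment> \<open>A point \<open>P x\<close> at which the interval of \<open>x\<close> is nondegenerate.\<close>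
  have "\<exists>p. f x 0 p < f x 1 p" if "x \<in> X" for x
    using less[OF that] by (simp add: less_fun_def le_fun_def not_le)
  then obtain P where P: "\<And>x. x \<in> X \<Longrightarrow> f x 0 (P x) < f x 1 (P x)" by metis
  show ?thesis
  proof (rule representableI[where \<Phi> = "\<lambda>s t. nested (lo s t) (hi s t)"])
    show "linear_order_on (omega_power X) (omega_power_order X r)"
      by (rule linear_order_on_omega_power_order[OF assms(1)])
    show "baire1 (\<lambda>t. nested (lo s t) (hi s t))" if "s \<in> omega_power X" for s
      unfolding lo_def hi_def
      by (intro baire1_nested baire in_X[OF that] continuous_on_curve) auto
    fix s s' assume "(s, s') \<in> omega_power_order X r" "s \<noteq> s'"
    then obtain n where s: "s \<in> omega_power X" "s' \<in> omega_power X"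
      and n: "\<And>k. k < n \<Longrightarrow> s k = s' k" "(s n, s' n) \<in> r" "s n \<noteq> s' n"
      by (auto simp: omega_power_order_def relation_of_def)
    have eq: "lo s t k = lo s' t k \<and> hi s t k = hi s' t k" if "k < n" for t k
      using n(1)[OF that] by (simp add: lo_def hi_def)
    have sep: "hi s t n \<le> lo s' t n" for t
      using le[OF n(2,3)] by (simp add: lo_def hi_def squash_le_iff le_fun_def)
    have weak: "nested (lo s t) (hi s t) \<le> nested (lo s' t) (hi s' t)" for t
      by (rule nested_mono[where n = n]) (use range lo_hi s eq sep in auto)
    obtain t where t: "\<And>k. k \<le> n \<Longrightarrow> curve k t = P (s k)"
      using curve_surj[of n "\<lambda>k. P (s k)"] by metis
    have "lo s t k < hi s t k" if "k \<le> n" for k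
      using P[OF in_X[OF s(1)]] t[OF that] by (simp add: lo_def hi_def squash_less_iff)
    then have "nested (lo s t) (hi s t) < nested (lo s' t) (hi s' t)"
      by (intro nested_strict_mono[where n = n]) (use range lo_hi s eq sep in auto)
    with weak show "(\<lambda>t. nested (lo s t) (hi s t)) < (\<lambda>t. nested (lo s' t) (hi s' t))"
      unfolding less_fun_def le_fun_def by (meson not_le)
  qed
qed

end
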